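(* Let $H_{112,211}(x;k)=\sum_{n\ge0}f_{112,211}(n,k)x^n$. Then $H_{112,211}(x;0)=1$ and for every $k\ge1$, \[ H_{112,211}(x;k)=(1+x+x^2)H_{112,211}(x;k-1)+\frac{x^3}{1-x}+x^2\frac{d}{dx}H_{112,211}(x;k-1). \]
   Context: For integers $k,n\ge 0$, a word is an element of $[k]^n$, where $[k]=\{1,\dots,k\}$ is totally ordered. A pattern is a word $\tau\in[\ell]^m$ containing every letter $1,\dots,\ell$. A word $\sigma\in[k]^n$ contains $\tau$ if there are indices $1\le i_1<\dots<i_m\le n$ such that for all $1\le a,b\le m$ and each relation $\phi\in\{<,=,>\}$, $\sigma(i_a)\,\phi\,\sigma(i_b)$ holds iff $\tau(a)\,\phi\,\tau(b)$ holds; otherwise $\sigma$ avoids $\tau$. $f_{112,211}(n,k)$ is the number of words in $[k]^n$ that avoid both $112$ and $211$. Generating functions are formal power series in $x$. *)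

theory Defs
  imports Complex_Main "HOL-Computational_Algebra.Formal_Power_Series"
begin

definition words :: "nat \<Rightarrow> nat \<Rightarrow> nat list set" where
  "words k n = {w. length w = n \<and> set w \<subseteq> {1..k}}"

definition is_pattern :: "nat list \<Rightarrow> bool" where
  "is_pattern \<tau> \<longleftrightarrow> (\<exists>l. set \<tau> = {1..l})"

text \<open>List positions start at 0, so the position map \<open>i\<close> goes from \<open>{..<m}\<close> to \<open>{..<n}\<close>,
  where the informal definition has \<open>1 \<le> i\<^sub>1 < \<dots> < i\<^sub>m \<le> n\<close>.\<close>

definition contains_pattern :: "nat list \<Rightarrow> nat list \<Rightarrow> bool" where
  "contains_pattern \<sigma> \<tau> \<longleftrightarrow>
     (\<exists>i :: nat \<Rightarrow> nat.
        strict_mono_on {..<length \<tau>} i \<and>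
        (\<forall>a<length \<tau>. i a < length \<sigma>) \<and>
        (\<forall>a<length \<tau>. \<forall>b<length \<tau>.
           (\<sigma> ! i a < \<sigma> ! i b \<longleftrightarrow> \<tau> ! a < \<tau> ! b) \<and>
           (\<sigma> ! i a = \<sigma> ! i b \<longleftrightarrow> \<tau> ! a = \<tau> ! b) \<and>
           (\<sigma> ! i a > \<sigma> ! i b \<longleftrightarrow> \<tau> ! a > \<tau> ! b)))"

abbreviation avoids_pattern :: "nat list \<Rightarrow> nat list \<Rightarrow> bool" where
  "avoids_pattern \<sigma> \<tau> \<equiv> \<not> contains_pattern \<sigma> \<tau>"

lemma is_pattern_112: "is_pattern [1, 1, 2]"
  unfolding is_pattern_def by (rule exI[of _ 2]) auto

lemma is_pattern_211: "is_pattern [2, 1, 1]"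
  unfolding is_pattern_def by (rule exI[of _ 2]) auto

definition f_112_211 :: "nat \<Rightarrow> nat \<Rightarrow> nat" where
  "f_112_211 n k =
     card {\<sigma> \<in> words k n. avoids_pattern \<sigma> [1, 1, 2] \<and> avoids_pattern \<sigma> [2, 1, 1]}"

text \<open>Rational coefficients are used because division of formal power series is available
  over a field.\<close>

definition H_112_211 :: "nat \<Rightarrow> rat fps" where
  "H_112_211 k = Abs_fps (\<lambda>n. of_nat (f_112_211 n k))"

end

theory Submission
  imports Defs "HOL-Library.Sublist"
begin

text \<open>Classify the words by the number of letters 1, the smallest letter. In an avoiding word no
  larger letter follows the second 1 or precedes the second to last 1. Hence a single 1 can be
  inserted anywhere into an avoiding word over the other letters, two 1s must surround such a word,
  and three or more 1s leave no room for other letters. On coefficients this gives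
  \<open>f n (k + 1) = f n k + n f (n - 1) k + f (n - 2) k + 1\<close>, without the third term if
  \<open>n < 2\<close> and without the last if \<open>n < 3\<close>.\<close>

section \<open>Pattern containment and subsequences\<close>

lemma subseq_Cons_iff_nth:
  "subseq (x # xs) ys \<longleftrightarrow> (\<exists>p<length ys. ys ! p = x \<and> subseq xs (drop (Suc p) ys))"
proof
  assume "subseq (x # xs) ys"
  then obtain us vs where "ys = us @ x # vs" "subseq xs vs"
    by (blast dest: list_emb_ConsD)
  then show "\<exists>p<length ys. ys ! p = x \<and> subseq xs (drop (Suc p) ys)"
    by (intro exI[of _ "length us"]) simp
next
  assume "\<exists>p<length ys. ys ! p = x \<and> subseq xs (drop (Suc p) ys)"
  then obtain p where p: "p < length ys" "ys ! p = x" "subseq xs (drop (Suc p) ys)"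
    by blast
  have "subseq (x # xs) (take p ys @ x # drop (Suc p) ys)"
    using p(3) by (intro list_emb_append2) simp
  then show "subseq (x # xs) ys"
    using p id_take_nth_drop[of p ys] by simp
qed

lemma subseq_triple_iff_nth:
  "subseq [x, y, z] ys \<longleftrightarrow>
    (\<exists>p q r. p < q \<and> q < r \<and> r < length ys \<and> ys ! p = x \<and> ys ! q = y \<and> ys ! r = z)"
proof
  assume "subseq [x, y, z] ys"
  \<comment> \<open>Here \<open>q\<close> and \<open>r\<close> are counted inside the successive
    suffixes left by \<open>drop\<close>, so the absolute positions are the sums used as witnesses
    below.\<close>
  then obtain p q r where "p < length ys" "ys ! p = x" "q < length ys - Suc p"
    "ys ! (Suc p + q) = y" "r < length ys - Suc (Suc p + q)" "ys ! (Suc (Suc p + q) + r) = z"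
    by (auto simp: subseq_Cons_iff_nth add_ac)
  then show "\<exists>p q r. p < q \<and> q < r \<and> r < length ys \<and> ys ! p = x \<and> ys ! q = y \<and> ys ! r = z"
    by (intro exI[of _ p] exI[of _ "Suc p + q"] exI[of _ "Suc (Suc p + q) + r"]) auto
next
  assume "\<exists>p q r. p < q \<and> q < r \<and> r < length ys \<and> ys ! p = x \<and> ys ! q = y \<and> ys ! r = z"
  then obtain p q r where *: "p < q" "q < r" "r < length ys" "ys ! p = x" "ys ! q = y" "ys ! r = z"
    by blast
  have "subseq [z] (drop (Suc q) ys)"
    unfolding subseq_Cons_iff_nth using * by (intro exI[of _ "r - Suc q"]) auto
  then have "subseq [y, z] (drop (Suc p) ys)"
    unfolding subseq_Cons_iff_nth[of y] using * by (intro exI[of _ "q - Suc p"]) auto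
  then show "subseq [x, y, z] ys"
    unfolding subseq_Cons_iff_nth[of x] using * by (intro exI[of _ p]) auto
qed

text \<open>The values found at the three positions form a subsequence, so the position map can be
  traded for \<open>subseq\<close>. Three pairs and the relations \<open><\<close> and
  \<open>=\<close> suffice: in a linear order they determine \<open>>\<close>, and comparing a
  position with itself is trivial.\<close>

lemma contains_pattern_triple_iff:
  "contains_pattern w [s, t, u] \<longleftrightarrow>
    (\<exists>x y z. subseq [x, y, z] w \<and> (x < y \<longleftrightarrow> s < t) \<and> (x = y \<longleftrightarrow> s = t) \<and>
      (x < z \<longleftrightarrow> s < u) \<and> (x = z \<longleftrightarrow> s = u) \<and> (y < z \<longleftrightarrow> t < u) \<and> (y = z \<longleftrightarrow> t = u))"
    (is "_ \<longleftrightarrow> ?R")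
proof
  assume "contains_pattern w [s, t, u]"
  then obtain i :: "nat \<Rightarrow> nat" where mono: "strict_mono_on {..<3} i"
    and len: "\<forall>a<3. i a < length w"
    and cmp: "\<forall>a<3. \<forall>b<3. (w ! i a < w ! i b \<longleftrightarrow> [s, t, u] ! a < [s, t, u] ! b) \<and>
           (w ! i a = w ! i b \<longleftrightarrow> [s, t, u] ! a = [s, t, u] ! b) \<and>
           (w ! i a > w ! i b \<longleftrightarrow> [s, t, u] ! a > [s, t, u] ! b)"
    unfolding contains_pattern_def by (auto simp: numeral_3_eq_3)
  have "i 0 < i 1" "i 1 < i 2"
    using mono by (auto simp: strict_mono_on_def)
  then have "subseq [w ! i 0, w ! i 1, w ! i 2] w"
    unfolding subseq_triple_iff_nth using len by (metis lessI numeral_2_eq_2 numeral_3_eq_3)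
  then show ?R
    using cmp[rule_format, of 0 1] cmp[rule_format, of 0 2] cmp[rule_format, of 1 2]
    by (intro exI[of _ "w ! i 0"] exI[of _ "w ! i 1"] exI[of _ "w ! i 2"]) simp
next
  assume ?R
  then obtain x y z where "subseq [x, y, z] w"
    and cmp: "x < y \<longleftrightarrow> s < t" "x = y \<longleftrightarrow> s = t" "x < z \<longleftrightarrow> s < u" "x = z \<longleftrightarrow> s = u"
      "y < z \<longleftrightarrow> t < u" "y = z \<longleftrightarrow> t = u"
    by blast
  have flip: "(b < a \<longleftrightarrow> d < c) \<and> (b = a \<longleftrightarrow> d = c)" if "a < b \<longleftrightarrow> c < d" "a = b \<longleftrightarrow> c = d"
    for a b c d :: nat
    using that by linarith
  have cmp': "y < x \<longleftrightarrow> t < s" "y = x \<longleftrightarrow> t = s" "z < x \<longleftrightarrow> u < s" "z = x \<longleftrightarrow> u = s"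
      "z < y \<longleftrightarrow> u < t" "z = y \<longleftrightarrow> u = t"
    using flip[OF cmp(1,2)] flip[OF cmp(3,4)] flip[OF cmp(5,6)] by blast+
  from \<open>subseq [x, y, z] w\<close>
  obtain p q r where pqr: "p < q" "q < r" "r < length w" "w ! p = x" "w ! q = y" "w ! r = z"
    unfolding subseq_triple_iff_nth by blast
  \<comment> \<open>List lookup serves as the position map; only its values at 0, 1 and 2 are
    inspected.\<close>
  define i where "i = (!) [p, q, r]"
  have less_3: "(\<forall>a<length [s, t, u]. P a) \<longleftrightarrow> P 0 \<and> P (Suc 0) \<and> P (Suc (Suc 0))" for P
    by (auto simp: less_Suc_eq)
  have "strict_mono_on {..<length [s, t, u]} i"
    using pqr by (auto simp: strict_mono_on_def i_def less_Suc_eq)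
  moreover have "\<forall>a<length [s, t, u]. i a < length w"
    using pqr unfolding less_3 by (auto simp: i_def)
  moreover have "\<forall>a<length [s, t, u]. \<forall>b<length [s, t, u].
      (w ! i a < w ! i b \<longleftrightarrow> [s, t, u] ! a < [s, t, u] ! b) \<and>
      (w ! i a = w ! i b \<longleftrightarrow> [s, t, u] ! a = [s, t, u] ! b) \<and>
      (w ! i a > w ! i b \<longleftrightarrow> [s, t, u] ! a > [s, t, u] ! b)"
    using pqr cmp cmp' unfolding less_3 by (simp add: i_def)
  ultimately show "contains_pattern w [s, t, u]"
    unfolding contains_pattern_def by blast
qed

section \<open>Avoidance as forbidden subsequences\<close>

text \<open>Joint avoidance of 112 and 211, phrased through letters instead of positions so that the
  calculus of \<open>subseq\<close> under \<open>filter\<close>, \<open>map\<close> and append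
  applies.\<close>

definition good :: "'a::linorder list \<Rightarrow> bool" where
  "good w \<longleftrightarrow> (\<forall>a b. a < b \<longrightarrow> \<not> subseq [a, a, b] w \<and> \<not> subseq [b, a, a] w)"

lemma avoids_112_211_iff_good:
  "avoids_pattern w [1, 1, 2] \<and> avoids_pattern w [2, 1, 1] \<longleftrightarrow> good w"
proof -
  have "contains_pattern w [1, 1, 2] \<longleftrightarrow> (\<exists>a b. a < b \<and> subseq [a, a, b] w)"
    unfolding contains_pattern_triple_iff by auto
  moreover have "contains_pattern w [2, 1, 1] \<longleftrightarrow> (\<exists>a b. a < b \<and> subseq [b, a, a] w)"
    unfolding contains_pattern_triple_iff by fastforce
  ultimately show ?thesis
    unfolding good_def by blast
qed

text \<open>\<open>Suc\<close> is strictly increasing, hence preserves and reflects the order of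
  letters. It identifies words over 1, ..., k with words over 2, ..., k + 1, which frees the letter
  1.\<close>

lemma good_map_Suc: "good (map Suc v) \<longleftrightarrow> good v"
proof -
  \<comment> \<open>Subsequences are selections by index sets, and \<open>nths\<close> commutes with
    \<open>map\<close>.\<close>
  have map_iff: "subseq xs (map Suc v) \<longleftrightarrow> (\<exists>ys. xs = map Suc ys \<and> subseq ys v)" for xs
    unfolding subseq_conv_nths nths_map by blast
  show ?thesis
  proof
    assume good: "good (map Suc v)"
    show "good v"
      unfolding good_def
    proof (intro allI impI)
      fix a b :: nat assume "a < b"
      then show "\<not> subseq [a, a, b] v \<and> \<not> subseq [b, a, a] v"
        using good subseq_map[of "[a, a, b]" v Suc] subseq_map[of "[b, a, a]" v Suc]
        by (auto simp: good_def)
    qed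
  next
    assume "good v"
    then show "good (map Suc v)"
      unfolding good_def map_iff by (fastforce simp: Cons_eq_map_conv)
  qed
qed

section \<open>Effect of the letter 1 on avoidance\<close>

text \<open>A forbidden subsequence whose smaller letter exceeds 1 contains no 1 at all, so it
  survives deletion of the 1s and is an obstruction for \<open>v\<close>. What remains are the
  obstructions with smaller letter 1, listed explicitly.\<close>

lemma good_iff_filter:
  fixes w :: "nat list"
  assumes "filter (\<lambda>x. x \<noteq> 1) w = map Suc v" and "set w \<subseteq> {1..}"
  shows "good w \<longleftrightarrow> good v \<and> (\<forall>b>1. \<not> subseq [1, 1, b] w \<and> \<not> subseq [b, 1, 1] w)"
proof -
  have filt: "subseq [x, y, z] w \<longleftrightarrow> subseq [x, y, z] (map Suc v)" if "x > 1" "y > 1" "z > 1" for x y z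
  proof
    assume "subseq [x, y, z] w"
    from subseq_filter[OF this, of "\<lambda>x. x \<noteq> 1"] show "subseq [x, y, z] (map Suc v)"
      using that assms(1) by simp
  next
    assume "subseq [x, y, z] (map Suc v)"
    then show "subseq [x, y, z] w"
      using subseq_filter_left[of "\<lambda>x. x \<noteq> 1" w] assms(1) subseq_order.trans by metis
  qed
  show ?thesis
  proof
    assume good: "good w"
    have "good (map Suc v)"
      using good subseq_filter_left[of "\<lambda>x. x \<noteq> 1" w] unfolding good_def assms(1)
      by (meson subseq_order.trans)
    then show "good v \<and> (\<forall>b>1. \<not> subseq [1, 1, b] w \<and> \<not> subseq [b, 1, 1] w)"
      using good unfolding good_map_Suc by (auto simp: good_def)
  next
    assume r: "good v \<and> (\<forall>b>1. \<not> subseq [1, 1, b] w \<and> \<not> subseq [b, 1, 1] w)"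
    have "\<not> subseq [a, a, b] w \<and> \<not> subseq [b, a, a] w" if "a < b" for a b
    proof (cases "a > 1")
      case True
      then show ?thesis
        using r filt[of a a b] filt[of b a a] \<open>a < b\<close> unfolding good_map_Suc[of v, symmetric]
        by (metis good_def less_trans)
    next
      case False
      \<comment> \<open>The only other value is 0, which is not a letter of
        \<open>w\<close>.\<close>
      then have "a = 1 \<or> a \<notin> set w"
        using assms(2) by (cases a) auto
      moreover have "a \<in> set w" if "subseq xs w" "a \<in> set xs" for xs
        using that by (blast elim: list_emb_set)
      ultimately show ?thesis
        using r \<open>a < b\<close> by (metis list.set_intros)
    qed
    then show "good w"
      by (simp add: good_def)
  qed
qed

text \<open>An obstruction with smaller letter 1 would need two 1s, so a single 1 is harmless
  wherever it stands.\<close>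

lemma good_if_one_1:
  assumes "set xs \<subseteq> {2..}" "set ys \<subseteq> {2..}" "xs @ ys = map Suc v"
  shows "good (xs @ 1 # ys) \<longleftrightarrow> good v"
proof -
  have no1: "filter (\<lambda>x. x \<noteq> 1) (xs @ 1 # ys) = xs @ ys" "filter (\<lambda>x. x = 1) (xs @ 1 # ys) = [1]"
  proof -
    have "x \<noteq> 1" if "x \<in> set xs \<union> set ys" for x
      using that assms(1,2) by force
    then show "filter (\<lambda>x. x \<noteq> 1) (xs @ 1 # ys) = xs @ ys" "filter (\<lambda>x. x = 1) (xs @ 1 # ys) = [1]"
      by (simp_all add: filter_id_conv filter_empty_conv)
  qed
  \<comment> \<open>Restricting an embedding to the 1s would embed a list of length 2 into
    \<open>[1]\<close>.\<close>
  have "\<not> subseq zs (xs @ 1 # ys)" if "length (filter (\<lambda>x. x = 1) zs) = 2" for zs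
  proof
    assume "subseq zs (xs @ 1 # ys)"
    from list_emb_length[OF subseq_filter[OF this, of "\<lambda>x. x = 1"]] show False
      unfolding no1 that by simp
  qed
  then have "\<not> subseq [1, 1, b] (xs @ 1 # ys) \<and> \<not> subseq [b, 1, 1] (xs @ 1 # ys)" if "b > 1" for b
    using that by simp
  moreover have "set (xs @ 1 # ys) \<subseteq> {1..}"
    using assms(1,2) by auto
  ultimately show ?thesis
    using good_iff_filter[of "xs @ 1 # ys" v] no1(1) assms(3) by metis
qed

text \<open>With the two 1s at the ends, every larger letter lies between them: none follows both 1s
  and none precedes both.\<close>

lemma good_if_two_1s:
  assumes "set v \<subseteq> {1..}"
  shows "good (1 # map Suc v @ [1]) \<longleftrightarrow> good v"
proof -
  have "\<not> subseq [1, 1, b] (1 # map Suc v @ [1])" "\<not> subseq [b, 1, 1] (1 # map Suc v @ [1])"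
    if "b > 1" for b
  proof -
    \<comment> \<open>The final 1 can match only the last letter of the subsequence, and only if
      that letter is 1. In either case some 1 must be matched inside \<open>u\<close>, which is
      impossible for \<open>map Suc v\<close>.\<close>
    have "1 \<in> set u" if "subseq [1, b] (u @ [1]) \<or> subseq [b, 1, 1] (u @ [1])" for u
      using that \<open>b > 1\<close>
      by (auto simp: subseq_append_iff Cons_eq_append_conv subseq_singleton_left
          dest!: list_emb_ConsD)
    from this[of "map Suc v"]
    show "\<not> subseq [1, 1, b] (1 # map Suc v @ [1])" "\<not> subseq [b, 1, 1] (1 # map Suc v @ [1])"
      using assms \<open>b > 1\<close> by auto
  qed
  moreover have "filter (\<lambda>x. x \<noteq> 1) (1 # map Suc v @ [1]) = map Suc v"
    using assms by (auto simp: filter_id_conv)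
  moreover have "set (1 # map Suc v @ [1]) \<subseteq> {1..}"
    by auto
  ultimately show ?thesis
    using good_iff_filter by metis
qed

lemma good_replicate: "good (replicate n c)"
proof -
  have "x = c" if "subseq xs (replicate n c)" "x \<in> set xs" for x xs
    using that by (auto elim!: list_emb_set)
  then show ?thesis
    unfolding good_def by (metis list.set_intros less_irrefl)
qed

text \<open>The displayed 1s are the first two. A larger letter in \<open>vs\<close> would complete
  112, and one in \<open>xs\<close> would start 211. If \<open>vs\<close> is nonempty it supplies a
  third 1, and then a letter of \<open>us\<close> would start 211 as well.\<close>

lemma good_two_1s_cases:
  assumes "good w" "set w \<subseteq> {1..}" "w = xs @ 1 # us @ 1 # vs" "1 \<notin> set xs" "1 \<notin> set us"
  shows "xs = [] \<and> (vs = [] \<or> us = [] \<and> vs = replicate (length vs) 1)"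
proof -
  have no_sub: "\<not> subseq [1, 1, b] w" "\<not> subseq [b, 1, 1] w" if "b > 1" for b
    using assms(1) that by (auto simp: good_def)
  have vs1: "b = 1" if "b \<in> set vs" for b
  proof (rule ccontr)
    assume "b \<noteq> 1"
    then have "b > 1"
      using that assms(2,3) by auto
    moreover have "subseq [1, 1, b] w"
      using that unfolding assms(3) by (auto intro!: subseq_drop_many simp: subseq_singleton_left)
    ultimately show False
      using no_sub by blast
  qed
  have "xs = []"
  proof (rule ccontr)
    assume "xs \<noteq> []"
    then have b: "hd xs \<in> set xs"
      by simp
    then have "hd xs \<in> set w" "hd xs \<noteq> 1"
      using assms(3,4) by auto
    then have "hd xs > 1"
      using assms(2) by force
    \<comment> \<open>The letter is matched inside \<open>xs\<close> and the two 1s in the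
      remainder.\<close>
    moreover have "subseq ([hd xs] @ [1, 1]) w"
      using b unfolding assms(3)
      by (intro list_emb_append_mono) (auto intro!: subseq_drop_many simp: subseq_singleton_left)
    ultimately show False
      using no_sub by auto
  qed
  moreover have "us = []" if "vs \<noteq> []"
  proof (rule ccontr)
    assume "us \<noteq> []"
    then have b: "hd us \<in> set us"
      by simp
    then have "hd us \<in> set w" "hd us \<noteq> 1"
      using assms(3,5) by auto
    then have "hd us > 1"
      using assms(2) by force
    moreover have "1 \<in> set vs"
      using that vs1 by (metis list.set_sel(1))
    then have "subseq ([hd us] @ [1, 1]) (us @ 1 # vs)"
      using b by (intro list_emb_append_mono) (auto simp: subseq_singleton_left)
    then have "subseq [hd us, 1, 1] w"
      unfolding assms(3) by (auto intro!: subseq_drop_many)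
    ultimately show False
      using no_sub by auto
  qed
  moreover have "vs = replicate (length vs) 1"
    using vs1 by (metis replicate_eqI)
  ultimately show ?thesis
    by blast
qed

section \<open>Decomposition by the number of 1s\<close>

definition good_words :: "nat \<Rightarrow> nat \<Rightarrow> nat list set" where
  "good_words k n = {w \<in> words k n. good w}"

lemma f_112_211_eq: "f_112_211 n k = card (good_words k n)"
  unfolding f_112_211_def good_words_def avoids_112_211_iff_good ..

lemma finite_good_words: "finite (good_words k n)"
proof (rule finite_subset)
  show "good_words k n \<subseteq> {w. set w \<subseteq> {1..k} \<and> length w = n}"
    by (auto simp: good_words_def words_def)
qed (simp add: finite_lists_length_eq)

text \<open>Taking a pair lets the words with one 1 appear as the image of a cartesian product;
  \<open>p\<close> is the position of the 1, counted from 0.\<close>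

definition insert1 :: "nat \<times> nat list \<Rightarrow> nat list" where
  "insert1 = (\<lambda>(p, v). map Suc (take p v) @ 1 # map Suc (drop p v))"

definition surround1 :: "nat list \<Rightarrow> nat list" where
  "surround1 v = 1 # map Suc v @ [1]"

lemma map_Suc_preimage:
  assumes "set xs \<subseteq> {2..Suc k}"
  obtains v where "xs = map Suc v" "set v \<subseteq> {1..k}"
proof
  \<comment> \<open>Every letter is at least 2, so the truncated subtraction is genuine.\<close>
  have "map (Suc \<circ> (\<lambda>x. x - 1)) xs = xs"
    by (rule map_idI) (use assms in force)
  then show "xs = map Suc (map (\<lambda>x. x - 1) xs)"
    by simp
  show "set (map (\<lambda>x. x - 1) xs) \<subseteq> {1..k}"
    using assms by (auto simp: subset_iff)
qed

text \<open>The four sets collect the words with no, one, two, and at least three 1s. For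
  \<open>n = 0\<close> the range of positions is empty, so the truncated \<open>n - 1\<close> does
  no harm. The guard \<open>n \<ge> 2\<close> keeps the truncated \<open>n - 2\<close> from
  producing words of the wrong length, and \<open>n \<ge> 3\<close> keeps the last set disjoint from
  the others.\<close>

lemma good_words_Suc:
  "good_words (Suc k) n = map Suc ` good_words k n
     \<union> insert1 ` ({..<n} \<times> good_words k (n - 1))
     \<union> (if n \<ge> 2 then surround1 ` good_words k (n - 2) else {})
     \<union> (if n \<ge> 3 then {replicate n 1} else {})"
  (is "_ = ?A \<union> ?B \<union> ?C \<union> ?D")
proof (intro subset_antisym subsetI)
  fix w assume "w \<in> good_words (Suc k) n"
  then have w: "length w = n" "set w \<subseteq> {1..Suc k}" "good w"
    by (auto simp: good_words_def words_def)
  have gt1: "set zs \<subseteq> {2..Suc k}" if zs: "set zs \<subseteq> set w" "1 \<notin> set zs" for zs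
  proof
    fix x assume "x \<in> set zs"
    then have "x \<in> {1..Suc k}" "x \<noteq> 1"
      using zs w(2) by auto
    then show "x \<in> {2..Suc k}"
      by auto
  qed
  show "w \<in> ?A \<union> ?B \<union> ?C \<union> ?D"
  proof (cases "1 \<in> set w")
    case False
    then have "set w \<subseteq> {2..Suc k}"
      by (intro gt1) auto
    then obtain v where "w = map Suc v" "set v \<subseteq> {1..k}"
      by (rule map_Suc_preimage)
    then have "w \<in> ?A"
      using w by (auto simp: good_words_def words_def good_map_Suc)
    then show ?thesis by blast
  next
    case True
    then obtain xs ys where xs: "w = xs @ 1 # ys" "1 \<notin> set xs"
      by (meson split_list_first)
    show ?thesis
    proof (cases "1 \<in> set ys")
      case False
      then have ge2: "set xs \<subseteq> {2..Suc k}" "set ys \<subseteq> {2..Suc k}"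
        using gt1 xs by auto
      then obtain v where v: "xs @ ys = map Suc v" "set v \<subseteq> {1..k}"
        using map_Suc_preimage[of "xs @ ys" k] by auto
      have "good v"
        using good_if_one_1[OF _ _ v(1)] ge2 w(3) xs(1) by fastforce
      moreover have "length v = n - 1" "length xs < n"
        using w(1) xs(1) arg_cong[OF v(1), of length] by auto
      moreover have "w = insert1 (length xs, v)"
        by (simp add: insert1_def xs(1) take_map[symmetric] drop_map[symmetric] v(1)[symmetric])
      ultimately have "w \<in> ?B"
        using v(2) by (auto simp: good_words_def words_def)
      then show ?thesis by blast
    next
      case True
      then obtain us vs where us: "ys = us @ 1 # vs" "1 \<notin> set us"
        by (meson split_list_first)
      have "xs = [] \<and> (vs = [] \<or> us = [] \<and> vs = replicate (length vs) 1)"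
        using w xs us by (intro good_two_1s_cases[of w]) auto
      \<comment> \<open>Exactly two 1s, which then surround \<open>us\<close>, or at least three 1s
        and no other letter.\<close>
      then consider "xs = []" "vs = []" | m where "xs = []" "us = []" "vs = replicate (Suc m) 1"
        by (metis length_0_conv not0_implies_Suc)
      then show ?thesis
      proof cases
        case 1
        have "set us \<subseteq> {2..Suc k}"
          using gt1 us xs by auto
        then obtain v where v: "us = map Suc v" "set v \<subseteq> {1..k}"
          by (rule map_Suc_preimage)
        have wv: "w = surround1 v"
          using 1 xs us v by (simp add: surround1_def)
        have "set v \<subseteq> {1..}"
          using v(2) by auto
        then have "good v"
          using w(3) good_if_two_1s wv by (simp add: surround1_def)
        then have "w \<in> ?C"
          using wv w(1) v(2) by (auto simp: surround1_def good_words_def words_def)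
        then show ?thesis by blast
      next
        case 2
        then have "w = replicate (Suc (Suc (Suc m))) 1"
          using xs us by simp
        then have "w \<in> ?D"
          using w(1) by auto
        then show ?thesis by blast
      qed
    qed
  qed
next
  fix w assume "w \<in> ?A \<union> ?B \<union> ?C \<union> ?D"
  then consider "w \<in> ?A" | "w \<in> ?B" | "w \<in> ?C" | "w \<in> ?D"
    by blast
  then show "w \<in> good_words (Suc k) n"
  proof cases
    case 1
    then show ?thesis
      by (auto simp: good_words_def words_def good_map_Suc subset_iff)
  next
    case 2
    then obtain p v where p: "p < n" and v: "length v = n - 1" "set v \<subseteq> {1..k}" "good v"
      and w: "w = map Suc (take p v) @ 1 # map Suc (drop p v)"
      by (auto simp: good_words_def words_def insert1_def)
    have part: "set (map Suc (take p v)) \<subseteq> {2..Suc k}" "set (map Suc (drop p v)) \<subseteq> {2..Suc k}"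
      using v(2) by (auto dest!: in_set_takeD in_set_dropD)
    have "map Suc (take p v) @ map Suc (drop p v) = map Suc v"
      by (metis append_take_drop_id map_append)
    then have "good w"
      unfolding w using part v(3) by (subst good_if_one_1[of _ _ v]) auto
    moreover have "set w \<subseteq> {1..Suc k}"
      using part unfolding w by auto
    ultimately show ?thesis
      using p v(1) by (auto simp: good_words_def words_def w)
  next
    case 3
    then obtain v where v: "length v = n - 2" "set v \<subseteq> {1..k}" "good v" "n \<ge> 2"
      and w: "w = 1 # map Suc v @ [1]"
      by (auto simp: good_words_def words_def surround1_def split: if_splits)
    have "set v \<subseteq> {1..}"
      using v(2) by auto
    then show ?thesis
      using v good_if_two_1s by (auto simp: good_words_def words_def w)
  next
    case 4
    then show ?thesis
      by (auto simp: good_words_def words_def good_replicate split: if_splits)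
  qed
qed

section \<open>Counting avoiding words\<close>

text \<open>The shifted letters are at least 2, so the inserted 1 is the only one, and cutting there
  recovers both halves of \<open>v\<close>.\<close>

lemma inj_on_insert1: "inj_on insert1 ({..<n} \<times> good_words k (n - 1))"
proof (rule inj_onI, clarsimp)
  fix p v p' v'
  assume p: "p < n" "p' < n" and v: "v \<in> good_words k (n - Suc 0)" "v' \<in> good_words k (n - Suc 0)"
    and eq: "insert1 (p, v) = insert1 (p', v')"
  have no1: "1 \<notin> set (map Suc (take p v))" "1 \<notin> set (map Suc (drop p v))"
    using v by (auto simp: good_words_def words_def dest!: in_set_takeD in_set_dropD)
  have "take p v = take p' v'" "drop p v = drop p' v'"
    using eq unfolding insert1_def prod.case append_Cons_eq_iff[OF no1]
    by (simp_all add: inj_map_eq_map)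
  moreover from this have "v = v'"
    by (metis append_take_drop_id)
  moreover have "length v = n - 1" "length v' = n - 1"
    using v by (auto simp: good_words_def words_def)
  \<comment> \<open>Since \<open>p < n\<close> means \<open>p \<le> length v\<close>, the position
    is the length of \<open>take p v\<close>.\<close>
  ultimately show "p = p' \<and> v = v'"
    using p by (metis length_take min.absorb2 Suc_pred' less_Suc_eq_le not_less_zero neq0_conv diff_Suc_1 One_nat_def)
qed

lemma count_list_map_Suc_1: "set v \<subseteq> {1..} \<Longrightarrow> count_list (map Suc v) 1 = 0"
  by (auto simp: count_list_0_iff)

text \<open>The number of 1s separates the four pieces, so their cardinalities add up, and each map
  involved is injective. The factor \<open>n\<close> counts the places for a single 1.\<close>

lemma card_good_words_Suc:
  "card (good_words (Suc k) n) = card (good_words k n) + n * card (good_words k (n - 1))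
     + (if n \<ge> 2 then card (good_words k (n - 2)) else 0) + (if n \<ge> 3 then 1 else 0)"
proof -
  let ?A = "map Suc ` good_words k n"
  let ?B = "insert1 ` ({..<n} \<times> good_words k (n - 1))"
  let ?C = "if n \<ge> 2 then surround1 ` good_words k (n - 2) else {}"
  let ?D = "if n \<ge> 3 then {replicate n (1::nat)} else {}"
  have ge1: "set v \<subseteq> {1..}" if "v \<in> good_words k m" for v m
    using that by (auto simp: good_words_def words_def)
  have A: "count_list w 1 = 0" if "w \<in> ?A" for w
    using that count_list_map_Suc_1[OF ge1] by auto
  have B: "count_list w 1 = 1" if "w \<in> ?B" for w
  proof -
    from that obtain p v where v: "v \<in> good_words k (n - 1)"
      and w: "w = map Suc (take p v) @ 1 # map Suc (drop p v)"
      by (auto simp: insert1_def)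
    show ?thesis
      using count_list_map_Suc_1[of "take p v"] count_list_map_Suc_1[of "drop p v"]
        ge1[OF v] set_take_subset[of p v] set_drop_subset[of p v] unfolding w by auto
  qed
  have C: "count_list w 1 = 2" if "w \<in> ?C" for w
    using that count_list_map_Suc_1[OF ge1] by (auto simp: surround1_def split: if_splits)
  have rep: "count_list (replicate m (1::nat)) 1 = m" for m
    by (induction m) auto
  have D: "count_list w 1 \<ge> 3" if "w \<in> ?D" for w
    using that rep[of n] by (auto split: if_splits)
  have fin: "finite ?A" "finite ?B" "finite ?C" "finite ?D"
    using finite_good_words by auto
  have "?A \<inter> ?B = {}" "(?A \<union> ?B) \<inter> ?C = {}" "(?A \<union> ?B \<union> ?C) \<inter> ?D = {}"
    using A B C D by fastforce+
  then have "card (?A \<union> ?B \<union> ?C \<union> ?D) = card ?A + card ?B + card ?C + card ?D"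
    using fin by (simp only: card_Un_disjoint finite_Un simp_thms)
  moreover have "card ?A = card (good_words k n)"
    by (rule card_image) (simp add: inj_on_def inj_map_eq_map)
  moreover have "card ?B = n * card (good_words k (n - 1))"
    using inj_on_insert1 by (simp add: card_image card_cartesian_product)
  moreover have "inj_on surround1 S" for S
    by (auto simp: inj_on_def surround1_def inj_map_eq_map)
  then have "card ?C = (if n \<ge> 2 then card (good_words k (n - 2)) else 0)"
    by (simp add: card_image)
  moreover have "card ?D = (if n \<ge> 3 then 1 else 0)"
    by simp
  ultimately show ?thesis
    unfolding good_words_Suc by simp
qed

section \<open>Generating function\<close>

lemma good_words_0: "good_words 0 n = (if n = 0 then {[]} else {})"
  by (auto simp: good_words_def words_def good_def)

lemma H_112_211_0: "H_112_211 0 = 1"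
  by (rule fps_ext) (simp add: H_112_211_def f_112_211_eq good_words_0)

text \<open>Compare coefficients. With a(n) the coefficients of \<open>H_112_211 k\<close>, the
  derivative term contributes (n - 1) a(n - 1) and the summand \<open>fps_X * H_112_211 k\<close>
  one more a(n - 1), which together give the n a(n - 1) of the recurrence.\<close>

lemma H_112_211_Suc:
  includes fps_syntax
  shows "H_112_211 (Suc k) =
     (1 + fps_X + fps_X ^ 2) * H_112_211 k + fps_X ^ 3 / (1 - fps_X)
       + fps_X ^ 2 * fps_deriv (H_112_211 k)"
proof (rule fps_ext)
  fix n
  \<comment> \<open>The denominator is a unit with the geometric series as inverse, so the quotient
    has coefficient 1 exactly from degree 3 on.\<close>
  have geom: "fps_X ^ 3 / (1 - fps_X) = fps_X ^ 3 * (Abs_fps (\<lambda>_. 1) :: rat fps)"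
    by (simp add: fps_divide_unit fps_inverse_one_minus_fps_X)
  have lhs: "H_112_211 (Suc k) $ n =
      H_112_211 k $ n + of_nat n * H_112_211 k $ (n - 1)
        + (if n \<ge> 2 then H_112_211 k $ (n - 2) else 0) + (if n \<ge> 3 then 1 else 0)"
    by (simp add: H_112_211_def f_112_211_eq card_good_words_Suc)
  \<comment> \<open>From degree 2 on the subtractions in \<open>lhs\<close> are genuine. At
    \<open>n = 0\<close> the factor \<open>n\<close> removes the spurious coefficient, and at
    \<open>n = 1\<close> the derivative term is 0.\<close>
  consider "n = 0" | "n = 1" | m where "n = Suc (Suc m)"
    by (metis One_nat_def not0_implies_Suc)
  then show "H_112_211 (Suc k) $ n =
     ((1 + fps_X + fps_X ^ 2) * H_112_211 k + fps_X ^ 3 / (1 - fps_X)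
       + fps_X ^ 2 * fps_deriv (H_112_211 k)) $ n"
    unfolding lhs geom
    by cases (auto simp: distrib_right fps_X_power_mult_nth fps_X_power_mult_right_nth algebra_simps)
qed

theorem theorem7:
  shows "H_112_211 0 = 1 \<and>
    (\<forall>k::nat. k \<ge> 1 \<longrightarrow>
       H_112_211 k =
         (1 + fps_X + fps_X ^ 2) * H_112_211 (k - 1)
         + fps_X ^ 3 / (1 - fps_X)
         + fps_X ^ 2 * fps_deriv (H_112_211 (k - 1)))"
proof (intro conjI allI impI)
  fix k :: nat assume "k \<ge> 1"
  then show "H_112_211 k =
         (1 + fps_X + fps_X ^ 2) * H_112_211 (k - 1)
         + fps_X ^ 3 / (1 - fps_X)
         + fps_X ^ 2 * fps_deriv (H_112_211 (k - 1))"
    using H_112_211_Suc[of "k - 1"] by simp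
qed (rule H_112_211_0)

end
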